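(* Let $I$, $J$, $K\subseteq\mathbb{R}$ be open intervals, and let $E$, $F$, $G$ be normalizable semideviations on $I$, $J$, $K$, respectively, with normalizations $E^*,F^*,G^*$. Let $f\colon J\times K\to I$ be a differentiable function such that $\partial_1f,\partial_2f\ge0$ and $\partial_1f+\partial_2f>0$ on $J\times K$. Then the following assertions are equivalent: (i) for all $n\in\mathbb{N}$, $x\in J^n$, $y\in K^n$, $\lambda\in W_n(\mathbb{R})$: $\ \underline{\underline{\mathcal{D}}}_E(f(x,y),\lambda)\le f\big(\underline{\underline{\mathcal{D}}}_F(x,\lambda),\underline{\underline{\mathcal{D}}}_G(y,\lambda)\big)$; (ii) for all $n\in\mathbb{N}$, $x\in J^n$, $y\in K^n$, $\lambda\in W_n(\mathbb{R})$: $\ \underline{\mathcal{D}}_E(f(x,y),\lambda)\le f\big(\underline{\mathcal{D}}_F(x,\lambda),\underline{\mathcal{D}}_G(y,\lambda)\big)$; (iii) for all $n\in\mathbb{N}$, $x\in J^n$, $y\in K^n$, $\lambda\in W_n(\mathbb{R})$: $\ \overline{\mathcal{D}}_E(f(x,y),\lambda)\le f\big(\overline{\mathcal{D}}_F(x,\lambda),\overline{\mathcal{D}}_G(y,\lambda)\big)$; (iv) for all $n\in\mathbb{N}$, $x\in J^n$, $y\in K^n$, $\lambda\in W_n(\mathbb{R})$: $\ \overline{\overline{\mathcal{D}}}_E(f(x,y),\lambda)\le f\big(\overline{\overline{\mathcal{D}}}_F(x,\lambda),\overline{\overline{\mathcal{D}}}_G(y,\lambda)\big)$; (v) for all $n\in\mathbb{N}$,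 $x\in J^n$, $y\in K^n$, $\lambda\in W_n(\mathbb{R})$: $\ \underline{\underline{\mathcal{D}}}_E(f(x,y),\lambda)\le f\big(\overline{\overline{\mathcal{D}}}_F(x,\lambda),\overline{\overline{\mathcal{D}}}_G(y,\lambda)\big)$; (vi) for all $p,u\in J$ and $q,v\in K$: $\ E^*\big(f(p,q),f(u,v)\big)\le\partial_1f(u,v)\,F^*(p,u)+\partial_2f(u,v)\,G^*(q,v)$.
   Context: For $x=(x_1,\dots,x_n)\in J^n$ and $y=(y_1,\dots,y_n)\in K^n$, $f(x,y):=(f(x_1,y_1),\dots,f(x_n,y_n))\in I^n$. For $n\in\mathbb{N}$, $W_n(\mathbb{R})=\{(\lambda_1,\dots,\lambda_n)\in\mathbb{R}^n\mid\lambda_i\ge0\ \forall i,\ \lambda_1+\dots+\lambda_n>0\}$. For an interval $I$, a function $E\colon I\times I\to\mathbb{R}$ is a semideviation on $I$ if for all distinct $x,y\in I$ the sign of $E(x,y)$ equals the sign of $x-y$. For $(x,\lambda)\in I^n\times W_n(\mathbb{R})$ let $e(y)=\lambda_1E(x_1,y)+\cdots+\lambda_nE(x_n,y)$, $y\in I$, and define $\underline{\underline{\mathcal{D}}}_E(x,\lambda)=\inf\{y\in I\mid e(y)\le0\}$, $\ \overline{\overline{\mathcal{D}}}_E(x,\lambda)=\sup\{y\in I\mid e(y)\ge0\}$, $\underline{\mathcal{D}}_E(x,\lambda)=\inf\{y\in I\mid e(y)<0\}$, $\ \overline{\mathcal{D}}_E(x,\lambda)=\sup\{y\in I\mid e(y)>0\}$.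 A semideviation $E\colon I\times I\to\mathbb{R}$ is normalizable if (a) for all $x\in I$ the function $y\mapsto E(x,y)$ is continuous on $I$; (b) for all $x\in I$ the function $y\mapsto E(x,y)$ is differentiable at $y=x$ (with derivative $\partial_2E(x,x)$); (c) $x\mapsto\partial_2E(x,x)$ is strictly negative and continuous on $I$. Its normalization is $E^*(x,y)=\dfrac{E(x,y)}{-\partial_2E(y,y)}$. ($\partial_i$ denotes partial derivative with respect to the $i$-th variable.) *)

theory Defs
  imports "HOL-Analysis.Analysis"
begin

text \<open>
  An n-tuple is a function on the index set \<open>{1..n}\<close>; values at other indices are irrelevant.
  Functions on intervals are total functions of which only the values on the interval matter
  (the intervals are open, so this includes derivatives at their points).
\<close>

definition weights :: "nat \<Rightarrow> (nat \<Rightarrow> real) set"  where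
  "weights n = {l. (\<forall>i\<in>{1..n}. 0 \<le> l i) \<and> 0 < (\<Sum>i=1..n. l i)}"

definition semideviation :: "real set \<Rightarrow> (real \<Rightarrow> real \<Rightarrow> real) \<Rightarrow> bool" where
  "semideviation I E \<longleftrightarrow> (\<forall>x\<in>I. \<forall>y\<in>I. x \<noteq> y \<longrightarrow> sgn (E x y) = sgn (x - y))"

definition dev_sum :: "(real \<Rightarrow> real \<Rightarrow> real) \<Rightarrow> nat \<Rightarrow> (nat \<Rightarrow> real) \<Rightarrow> (nat \<Rightarrow> real) \<Rightarrow> real \<Rightarrow> real" where
  "dev_sum E n x l y = (\<Sum>i=1..n. l i * E (x i) y)"

text \<open>
  The suffixes \<open>ll\<close>, \<open>l\<close>, \<open>u\<close>, \<open>uu\<close> stand for double underline, underline, overline and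
  double overline.  For an open interval \<open>I\<close>, a semideviation on it, points of \<open>I\<close> and
  admissible weights, the sets below are nonempty and bounded on the relevant side, so the
  values of \<open>Inf\<close> and \<open>Sup\<close> on other sets of reals play no role.
\<close>

definition D_ll :: "real set \<Rightarrow> (real \<Rightarrow> real \<Rightarrow> real) \<Rightarrow> nat \<Rightarrow> (nat \<Rightarrow> real) \<Rightarrow> (nat \<Rightarrow> real) \<Rightarrow> real" where
  "D_ll I E n x l = Inf {y \<in> I. dev_sum E n x l y \<le> 0}"

definition D_l :: "real set \<Rightarrow> (real \<Rightarrow> real \<Rightarrow> real) \<Rightarrow> nat \<Rightarrow> (nat \<Rightarrow> real) \<Rightarrow> (nat \<Rightarrow> real) \<Rightarrow> real" where
  "D_l I E n x l = Inf {y \<in> I. dev_sum E n x l y < 0}"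

definition D_u :: "real set \<Rightarrow> (real \<Rightarrow> real \<Rightarrow> real) \<Rightarrow> nat \<Rightarrow> (nat \<Rightarrow> real) \<Rightarrow> (nat \<Rightarrow> real) \<Rightarrow> real" where
  "D_u I E n x l = Sup {y \<in> I. dev_sum E n x l y > 0}"

definition D_uu :: "real set \<Rightarrow> (real \<Rightarrow> real \<Rightarrow> real) \<Rightarrow> nat \<Rightarrow> (nat \<Rightarrow> real) \<Rightarrow> (nat \<Rightarrow> real) \<Rightarrow> real" where
  "D_uu I E n x l = Sup {y \<in> I. dev_sum E n x l y \<ge> 0}"

definition partial1 :: "(real \<times> real \<Rightarrow> real) \<Rightarrow> real \<Rightarrow> real \<Rightarrow> real" where
  "partial1 f u v = deriv (\<lambda>s. f (s, v)) u"

definition partial2 :: "(real \<times> real \<Rightarrow> real) \<Rightarrow> real \<Rightarrow> real \<Rightarrow> real" where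
  "partial2 f u v = deriv (\<lambda>t. f (u, t)) v"

definition normalizable :: "real set \<Rightarrow> (real \<Rightarrow> real \<Rightarrow> real) \<Rightarrow> bool" where
  "normalizable I E \<longleftrightarrow> semideviation I E \<and>
     (\<forall>x\<in>I. continuous_on I (\<lambda>y. E x y)) \<and>
     (\<forall>x\<in>I. (\<lambda>y. E x y) differentiable (at x)) \<and>
     (\<forall>x\<in>I. partial2 (\<lambda>(s, t). E s t) x x < 0) \<and>
     continuous_on I (\<lambda>x. partial2 (\<lambda>(s, t). E s t) x x)"

definition normalization :: "(real \<Rightarrow> real \<Rightarrow> real) \<Rightarrow> real \<Rightarrow> real \<Rightarrow> real" where
  "normalization E x y = E x y / (- partial2 (\<lambda>(s, t). E s t) y y)"

definition all_equivalent :: "bool list \<Rightarrow> bool" where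
  "all_equivalent Ps \<longleftrightarrow> (\<forall>P\<in>set Ps. \<forall>Q\<in>set Ps. P \<longleftrightarrow> Q)"

end

theory Submission
  imports Defs
begin

text \<open>
  Write \<open>e\<^sub>F\<close>, \<open>e\<^sub>G\<close>, \<open>e\<^sub>E\<close> for the weighted sums belonging to \<open>x\<close>, \<open>y\<close>, \<open>f(x, y)\<close>.  Averaging (vi) over
  the entries shows that \<open>e\<^sub>F(u) \<le> 0\<close> and \<open>e\<^sub>G(v) \<le> 0\<close> force \<open>e\<^sub>E(f(u, v)) \<le> 0\<close>, also with strict
  inequalities; this yields (i) and (ii) at once, and (iii), (iv) by the intermediate value
  theorem, as every value of \<open>f\<close> above \<open>f(u\<^sub>0, v\<^sub>0)\<close> that matters is attained at some
  \<open>(u, v)\<close> with \<open>u > u\<^sub>0\<close>, \<open>v > v\<^sub>0\<close>.  Each of (i)--(iv) implies (v) since \<open>f\<close> is increasing.  For (v)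
  \<open>\<Longrightarrow>\<close> (vi), give \<open>(p, q)\<close> the weight \<open>t\<close> and \<open>(u, v)\<close> the weight \<open>1 - t\<close>: any zero
  \<open>U(t)\<close> of \<open>t F(p, \<cdot>) + (1 - t) F(u, \<cdot>)\<close> has the right derivative \<open>F\<^sup>*(p, u)\<close> at \<open>t = 0\<close>,
  so (vi) is (v) differentiated at \<open>t = 0\<close>.
\<close>

section \<open>Semideviations and their means\<close>

lemma normalizableD:
  assumes "normalizable I E"
  shows "semideviation I E" "x \<in> I \<Longrightarrow> continuous_on I (E x)"
    and "x \<in> I \<Longrightarrow> partial2 (\<lambda>(s, t). E s t) x x < 0"
    and "x \<in> I \<Longrightarrow> (E x has_real_derivative partial2 (\<lambda>(s, t). E s t) x x) (at x)"
  using assms by (auto simp: normalizable_def partial2_def DERIV_deriv_iff_real_differentiable)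

lemma semideviation_sgn:
  assumes "semideviation I E" "x \<in> I" "y \<in> I"
  shows "x < y \<Longrightarrow> E x y < 0" "y < x \<Longrightarrow> E x y > 0"
proof -
  have *: "x \<noteq> y \<Longrightarrow> sgn (E x y) = sgn (x - y)"
    using assms by (auto simp: semideviation_def)
  show "x < y \<Longrightarrow> E x y < 0" "y < x \<Longrightarrow> E x y > 0"
    using * by (auto simp: sgn_if split: if_splits)
qed

lemma open_real_extend_right:
  fixes I :: "real set"
  assumes "open I" "d \<in> I" "0 < r"
  obtains y where "y \<in> I" "d < y" "y < d + r"
proof -
  obtain c where c: "c > 0" "ball d c \<subseteq> I"
    using assms openE by blast
  show thesis
    by (rule that[of "d + min c r / 2"]) (use c assms in \<open>auto simp: subset_iff dist_real_def\<close>)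
qed

lemma open_real_extend_left:
  fixes I :: "real set"
  assumes "open I" "d \<in> I" "0 < r"
  obtains y where "y \<in> I" "y < d" "d - r < y"
proof -
  obtain c where c: "c > 0" "ball d c \<subseteq> I"
    using assms openE by blast
  show thesis
    by (rule that[of "d - min c r / 2"]) (use c assms in \<open>auto simp: subset_iff dist_real_def\<close>)
qed

lemma continuous_on_pos_nbhd:
  fixes g :: "real \<Rightarrow> real"
  assumes "open I" "continuous_on I g" "d \<in> I" "0 < g d"
  obtains r where "r > 0" "ball d r \<subseteq> {y \<in> I. 0 < g y}"
proof -
  have "open {y \<in> I. 0 < g y}"
    using continuous_open_preimage[OF assms(2,1), of "{0<..}"]
    by (simp add: vimage_def Int_def)
  then show thesis
    using assms that openE[of "{y \<in> I. 0 < g y}" d] by blast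
qed

text \<open>The sign condition says nothing at \<open>y = x\<close>. Continuity fixes the value
  there: a positive value would persist slightly to the right of \<open>x\<close>, where
  \<open>E x\<close> is negative, and a negative one slightly to the left.\<close>

lemma semideviation_diag:
  assumes "open I" "semideviation I E" "continuous_on I (E x)" "x \<in> I"
  shows "E x x = 0"
proof (rule ccontr)
  assume "E x x \<noteq> 0"
  then consider "0 < E x x" | "0 < - E x x" by linarith
  then show False
  proof cases
    case 1
    then obtain r where r: "r > 0" "ball x r \<subseteq> {y \<in> I. 0 < E x y}"
      using continuous_on_pos_nbhd assms by blast
    then have "x + r / 2 \<in> {y \<in> I. 0 < E x y}"
      by (intro subsetD[OF r(2)]) (auto simp: dist_real_def)
    then show False
      using semideviation_sgn(1)[OF assms(2,4), of "x + r / 2"] r by auto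
  next
    case 2
    then obtain r where r: "r > 0" "ball x r \<subseteq> {y \<in> I. 0 < - E x y}"
      using continuous_on_pos_nbhd[of I "\<lambda>y. - E x y" x] assms continuous_on_minus by blast
    then have "x - r / 2 \<in> {y \<in> I. 0 < - E x y}"
      by (intro subsetD[OF r(2)]) (auto simp: dist_real_def)
    then show False
      using semideviation_sgn(2)[OF assms(2,4), of "x - r / 2"] r by auto
  qed
qed

section \<open>The four means of a weighted tuple: existence, bounds, order, zeros\<close>

locale weighted_tuple =
  fixes I :: "real set" and E :: "real \<Rightarrow> real \<Rightarrow> real" and n :: nat and x l :: "nat \<Rightarrow> real"
  assumes opn: "open I" and ivl: "is_interval I" and semidev: "semideviation I E"
    and cont: "\<And>x. x \<in> I \<Longrightarrow> continuous_on I (E x)"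
    and x_in: "x \<in> {1..n} \<rightarrow> I" and l_in: "l \<in> weights n"
begin

abbreviation e :: "real \<Rightarrow> real" where
  "e \<equiv> dev_sum E n x l"

lemma cont_e: "continuous_on I e"
  unfolding dev_sum_def using x_in by (intro continuous_intros cont) auto

lemma l_nonneg: "i \<in> {1..n} \<Longrightarrow> 0 \<le> l i"
  using l_in by (auto simp: weights_def)

lemma ex_pos_weight: obtains i where "i \<in> {1..n}" "0 < l i"
proof -
  have "\<exists>i\<in>{1..n}. 0 < l i"
  proof (rule ccontr)
    assume "\<not> ?thesis"
    then have "(\<Sum>i=1..n. l i) \<le> 0" by (intro sum_nonpos) (auto simp: not_less)
    then show False using l_in by (auto simp: weights_def)
  qed
  then show thesis using that by blast
qed

lemma e_pos:
  assumes "y \<in> I" "\<And>i. i \<in> {1..n} \<Longrightarrow> y < x i"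
  shows "0 < e y"
proof -
  have *: "0 < E (x i) y" if "i \<in> {1..n}" for i
    using that assms x_in by (intro semideviation_sgn[OF semidev]) auto
  obtain j where "j \<in> {1..n}" "0 < l j" by (rule ex_pos_weight)
  then show ?thesis
    unfolding dev_sum_def using * l_nonneg by (intro sum_pos2[of _ j]) (auto simp: less_imp_le)
qed

lemma e_neg:
  assumes "y \<in> I" "\<And>i. i \<in> {1..n} \<Longrightarrow> x i < y"
  shows "e y < 0"
proof -
  have *: "0 < - E (x i) y" if i: "i \<in> {1..n}" for i
  proof -
    have "x i \<in> I" using x_in i by blast
    then show ?thesis
      using semideviation_sgn(1)[OF semidev _ assms(1) assms(2)[OF i]] by simp
  qed
  obtain j where "j \<in> {1..n}" "0 < l j" by (rule ex_pos_weight)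
  then have "0 < (\<Sum>i=1..n. l i * - E (x i) y)"
    using * l_nonneg by (intro sum_pos2[of _ j] mult_pos_pos mult_nonneg_nonneg) (auto simp: less_imp_le)
  then show ?thesis by (simp add: dev_sum_def sum_negf)
qed

lemma ex_bounds:
  obtains a b where "a \<in> I" "b \<in> I" "\<And>i. i \<in> {1..n} \<Longrightarrow> a \<le> x i" "\<And>i. i \<in> {1..n} \<Longrightarrow> x i \<le> b"
proof -
  have ne: "x ` {1..n} \<noteq> {}" by (metis ex_pos_weight empty_iff image_is_empty)
  then have "Min (x ` {1..n}) \<in> x ` {1..n}" "Max (x ` {1..n}) \<in> x ` {1..n}"
    by (auto intro: Min_in Max_in)
  then show thesis
    using x_in by (intro that[of "Min (x ` {1..n})" "Max (x ` {1..n})"]) auto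
qed

lemma ex_strict_upper:
  obtains b where "b \<in> I" "\<And>i. i \<in> {1..n} \<Longrightarrow> x i < b"
  by (metis ex_bounds open_real_extend_right[OF opn _ zero_less_one] order_le_less_trans)

text \<open>Contrapositive of \<open>e_pos\<close>: strictly left of all entries the sum is
  positive. With its mirror image it makes the sets behind the four means bounded on the relevant
  side.\<close>

lemma nonpos_lower:
  assumes "a \<in> I" "\<And>i. i \<in> {1..n} \<Longrightarrow> a \<le> x i" "y \<in> I" "e y \<le> 0"
  shows "a \<le> y"
  using e_pos[of y] assms by force

lemma nonneg_upper:
  assumes "b \<in> I" "\<And>i. i \<in> {1..n} \<Longrightarrow> x i \<le> b" "y \<in> I" "0 \<le> e y"
  shows "y \<le> b"
  using e_neg[of y] assms by force

lemma bdd_below: "bdd_below {y \<in> I. e y \<le> 0}" "bdd_below {y \<in> I. e y < 0}"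
proof -
  show "bdd_below {y \<in> I. e y \<le> 0}"
    by (metis (mono_tags, lifting) bdd_belowI ex_bounds mem_Collect_eq nonpos_lower)
  then show "bdd_below {y \<in> I. e y < 0}" by (rule bdd_below_mono) auto
qed

lemma bdd_above: "bdd_above {y \<in> I. 0 \<le> e y}" "bdd_above {y \<in> I. 0 < e y}"
proof -
  show "bdd_above {y \<in> I. 0 \<le> e y}"
    by (metis (mono_tags, lifting) bdd_aboveI ex_bounds mem_Collect_eq nonneg_upper)
  then show "bdd_above {y \<in> I. 0 < e y}" by (rule bdd_above_mono) auto
qed

text \<open>At \<open>b\<close> itself the sum may vanish, for instance when every entry equals
  \<open>b\<close>. The strict sign is only guaranteed beyond \<open>b\<close>, where openness of
  \<open>I\<close> leaves room arbitrarily close by.\<close>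

lemma ex_neg_near:
  assumes "b \<in> I" "\<And>i. i \<in> {1..n} \<Longrightarrow> x i \<le> b" "0 < r"
  obtains y where "y \<in> I" "e y < 0" "y < b + r"
  by (metis assms e_neg open_real_extend_right[OF opn assms(1,3)] order_le_less_trans)

lemma ex_pos_near:
  assumes "a \<in> I" "\<And>i. i \<in> {1..n} \<Longrightarrow> a \<le> x i" "0 < r"
  obtains y where "y \<in> I" "0 < e y" "a - r < y"
  by (metis assms e_pos open_real_extend_left[OF opn assms(1,3)] order_less_le_trans)

lemma nonempty:
  "{y \<in> I. e y \<le> 0} \<noteq> {}" "{y \<in> I. e y < 0} \<noteq> {}"
  "{y \<in> I. 0 \<le> e y} \<noteq> {}" "{y \<in> I. 0 < e y} \<noteq> {}"
proof -
  obtain a b where ab: "a \<in> I" "b \<in> I"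
    "\<And>i. i \<in> {1..n} \<Longrightarrow> a \<le> x i" "\<And>i. i \<in> {1..n} \<Longrightarrow> x i \<le> b"
    using ex_bounds by blast
  show neg: "{y \<in> I. e y < 0} \<noteq> {}"
    using ex_neg_near[OF ab(2,4) zero_less_one] by blast
  show pos: "{y \<in> I. 0 < e y} \<noteq> {}"
    using ex_pos_near[OF ab(1,3) zero_less_one] by blast
  show "{y \<in> I. e y \<le> 0} \<noteq> {}" "{y \<in> I. 0 \<le> e y} \<noteq> {}"
    using neg pos by (auto intro: less_imp_le)
qed

lemma D_ll_le: "y \<in> I \<Longrightarrow> e y \<le> 0 \<Longrightarrow> D_ll I E n x l \<le> y"
  unfolding D_ll_def by (intro cInf_lower bdd_below) auto

lemma D_l_le: "y \<in> I \<Longrightarrow> e y < 0 \<Longrightarrow> D_l I E n x l \<le> y"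
  unfolding D_l_def by (intro cInf_lower bdd_below) auto

lemma D_u_ge: "y \<in> I \<Longrightarrow> 0 < e y \<Longrightarrow> y \<le> D_u I E n x l"
  unfolding D_u_def by (intro cSup_upper bdd_above) auto

lemma D_uu_ge: "y \<in> I \<Longrightarrow> 0 \<le> e y \<Longrightarrow> y \<le> D_uu I E n x l"
  unfolding D_uu_def by (intro cSup_upper bdd_above) auto

lemma D_l_approx:
  assumes "0 < r" obtains y where "y \<in> I" "e y < 0" "y < D_l I E n x l + r"
  using cInf_lessD[OF nonempty(2), of "D_l I E n x l + r"] assms that by (auto simp: D_l_def)

lemma D_le_iff:
  "D_u I E n x l \<le> z \<longleftrightarrow> (\<forall>y\<in>I. 0 < e y \<longrightarrow> y \<le> z)"
  "D_uu I E n x l \<le> z \<longleftrightarrow> (\<forall>y\<in>I. 0 \<le> e y \<longrightarrow> y \<le> z)"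
  unfolding D_u_def D_uu_def
  using cSup_le_iff[OF nonempty(3) bdd_above(1)] cSup_le_iff[OF nonempty(4) bdd_above(2)] by auto

lemma le_D_iff:
  "z \<le> D_l I E n x l \<longleftrightarrow> (\<forall>y\<in>I. e y < 0 \<longrightarrow> z \<le> y)"
  "z \<le> D_ll I E n x l \<longleftrightarrow> (\<forall>y\<in>I. e y \<le> 0 \<longrightarrow> z \<le> y)"
  unfolding D_l_def D_ll_def
  using le_cInf_iff[OF nonempty(1) bdd_below(1)] le_cInf_iff[OF nonempty(2) bdd_below(2)] by auto

lemma D_ll_le_D_l: "D_ll I E n x l \<le> D_l I E n x l"
  unfolding le_D_iff by (auto intro: D_ll_le)

lemma D_u_le_D_uu: "D_u I E n x l \<le> D_uu I E n x l"
  unfolding D_le_iff by (auto intro: D_uu_ge)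

context
  fixes a b assumes ab: "a \<in> I" "b \<in> I"
    "\<And>i. i \<in> {1..n} \<Longrightarrow> a \<le> x i" "\<And>i. i \<in> {1..n} \<Longrightarrow> x i \<le> b"
begin

text \<open>The bounds \<open>a\<close>, \<open>b\<close> are arbitrary points of \<open>I\<close>
  enclosing the entries, so that these estimates serve both for membership of the means in
  \<open>I\<close> and for locating two-point means between their two entries.\<close>

lemma D_ll_ge_bound: "a \<le> D_ll I E n x l"
  unfolding le_D_iff using nonpos_lower ab by blast

lemma D_l_le_bound: "D_l I E n x l \<le> b"
proof (rule field_le_epsilon)
  fix r :: real assume "0 < r"
  with ab obtain y where "y \<in> I" "e y < 0" "y < b + r" by (meson ex_neg_near)
  then show "D_l I E n x l \<le> b + r" using D_l_le[of y] by linarith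
qed

lemma D_uu_le_bound: "D_uu I E n x l \<le> b"
  unfolding D_le_iff using nonneg_upper ab by blast

lemma D_u_ge_bound: "a \<le> D_u I E n x l"
proof (rule field_le_epsilon)
  fix r :: real assume "0 < r"
  with ab obtain y where "y \<in> I" "0 < e y" "a - r < y" by (meson ex_pos_near)
  then show "a \<le> D_u I E n x l + r" using D_u_ge[of y] by linarith
qed

end

lemma D_mem:
  "D_ll I E n x l \<in> I" "D_l I E n x l \<in> I" "D_u I E n x l \<in> I" "D_uu I E n x l \<in> I"
proof -
  obtain a b where ab: "a \<in> I" "b \<in> I"
    "\<And>i. i \<in> {1..n} \<Longrightarrow> a \<le> x i" "\<And>i. i \<in> {1..n} \<Longrightarrow> x i \<le> b"
    using ex_bounds by blast
  have *: "d \<in> I" if "a \<le> d" "d \<le> b" for d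
    using ivl ab that unfolding is_interval_1 by blast
  note bounds = D_ll_ge_bound[OF ab] D_l_le_bound[OF ab] D_uu_le_bound[OF ab] D_u_ge_bound[OF ab]
  show "D_ll I E n x l \<in> I" "D_l I E n x l \<in> I" "D_u I E n x l \<in> I" "D_uu I E n x l \<in> I"
    using bounds D_ll_le_D_l D_u_le_D_uu by (auto intro!: *)
qed

text \<open>A point strictly between \<open>D_u\<close> and a larger \<open>D_ll\<close> would have
  \<open>e > 0\<close>, being below \<open>D_ll\<close>, and \<open>e \<le> 0\<close>, being above
  \<open>D_u\<close>.\<close>

lemma D_ll_le_D_u: "D_ll I E n x l \<le> D_u I E n x l"
proof (rule ccontr)
  assume less: "\<not> ?thesis"
  define m where "m = (D_ll I E n x l + D_u I E n x l) / 2"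
  have m: "D_u I E n x l < m" "m < D_ll I E n x l" using less by (auto simp: m_def)
  then have "m \<in> I" using D_mem ivl unfolding is_interval_1 by (meson less_imp_le)
  then show False using D_ll_le[of m] D_u_ge[of m] m by linarith
qed

lemma D_l_le_D_uu: "D_l I E n x l \<le> D_uu I E n x l"
proof (rule ccontr)
  assume less: "\<not> ?thesis"
  define m where "m = (D_l I E n x l + D_uu I E n x l) / 2"
  have m: "D_uu I E n x l < m" "m < D_l I E n x l" using less by (auto simp: m_def)
  then have "m \<in> I" using D_mem ivl unfolding is_interval_1 by (meson less_imp_le)
  then show False using D_l_le[of m] D_uu_ge[of m] m by linarith
qed

lemma D_ll_le_D_uu: "D_ll I E n x l \<le> D_uu I E n x l"
  using D_ll_le_D_l D_l_le_D_uu by linarith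

text \<open>A positive value would stay positive nearby, although points with
  \<open>e \<le> 0\<close> come arbitrarily close to the infimum. A negative value would put points
  left of the infimum into the set.\<close>

lemma e_D_ll: "e (D_ll I E n x l) = 0"
proof (rule ccontr)
  let ?d = "D_ll I E n x l"
  assume "e ?d \<noteq> 0"
  then consider "0 < e ?d" | "0 < - e ?d" by linarith
  then show False
  proof cases
    case 1
    then obtain r where r: "r > 0" "ball ?d r \<subseteq> {y \<in> I. 0 < e y}"
      using continuous_on_pos_nbhd opn cont_e D_mem(1) by blast
    obtain y where y: "y \<in> I" "e y \<le> 0" "y < ?d + r"
      using cInf_lessD[OF nonempty(1), of "?d + r"] r by (auto simp: D_ll_def)
    then have "y \<in> ball ?d r" using D_ll_le[of y] by (auto simp: dist_real_def)
    then show False using r y by fastforce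
  next
    case 2
    then obtain r where r: "r > 0" "ball ?d r \<subseteq> {y \<in> I. 0 < - e y}"
      using continuous_on_pos_nbhd[OF opn continuous_on_minus[OF cont_e] D_mem(1)] by blast
    have "?d - r / 2 \<in> {y \<in> I. 0 < - e y}"
      by (intro subsetD[OF r(2)]) (use r(1) in \<open>auto simp: dist_real_def\<close>)
    then show False using D_ll_le[of "?d - r / 2"] r(1) by auto
  qed
qed

lemma e_D_uu: "e (D_uu I E n x l) = 0"
proof (rule ccontr)
  let ?d = "D_uu I E n x l"
  assume "e ?d \<noteq> 0"
  then consider "0 < e ?d" | "0 < - e ?d" by linarith
  then show False
  proof cases
    case 1
    then obtain r where r: "r > 0" "ball ?d r \<subseteq> {y \<in> I. 0 < e y}"
      using continuous_on_pos_nbhd opn cont_e D_mem(4) by blast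
    have "?d + r / 2 \<in> {y \<in> I. 0 < e y}"
      by (intro subsetD[OF r(2)]) (use r(1) in \<open>auto simp: dist_real_def\<close>)
    then show False using D_uu_ge[of "?d + r / 2"] r(1) by auto
  next
    case 2
    then obtain r where r: "r > 0" "ball ?d r \<subseteq> {y \<in> I. 0 < - e y}"
      using continuous_on_pos_nbhd[OF opn continuous_on_minus[OF cont_e] D_mem(4)] by blast
    obtain y where y: "y \<in> I" "0 \<le> e y" "?d - r < y"
      using less_cSupD[OF nonempty(3), of "?d - r"] r by (auto simp: D_uu_def)
    then have "y \<in> ball ?d r" using D_uu_ge[of y] by (auto simp: dist_real_def)
    then show False using r y by fastforce
  qed
qed

end

lemma weighted_tupleI:
  assumes "open I" "is_interval I" "normalizable I E" "x \<in> {1..n} \<rightarrow> I" "l \<in> weights n"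
  shows "weighted_tuple I E n x l"
  using assms normalizableD[OF assms(3)] by unfold_locales auto

text \<open>\<open>U\<close> is any selection of zeros in the segment; its continuity at 0 is
  proved, not assumed, so the result covers the smallest and the largest zero alike. Solving the
  equation for the difference quotient gives \<open>(U t - u) / t = F p (U t) / (- (1 - t) * (F u (U
  t) / (U t - u)))\<close>, whose limit is \<open>F p u / (- c)\<close>.\<close>

lemma zero_of_mixture_has_derivative:
  fixes U :: "real \<Rightarrow> real"
  assumes J: "open J" "is_interval J" and F: "normalizable J F" and pu: "p \<in> J" "u \<in> J"
    and seg: "\<And>t. t \<in> {0..<1} \<Longrightarrow> U t \<in> closed_segment p u"
    and zero: "\<And>t. t \<in> {0..<1} \<Longrightarrow> t * F p (U t) + (1 - t) * F u (U t) = 0"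
  shows "U 0 = u" "(U has_real_derivative normalization F p u) (at 0 within {0..<1})"
proof -
  note N = normalizableD[OF F]
  have sub: "closed_segment p u \<subseteq> J"
    using J pu by (simp add: closed_segment_subset is_interval_convex_1)
  have nz: "F w y \<noteq> 0" if "w \<in> J" "y \<in> J" "w \<noteq> y" for w y
    using semideviation_sgn[OF N(1) that(1,2)] that(3) by (metis less_irrefl linorder_neqE)
  have Fuu: "F u u = 0" using semideviation_diag[OF J(1) N(1)] N(2) pu by blast
  show U0: "U 0 = u"
    using zero[of 0] seg[of 0] sub nz[of u "U 0"] pu by auto
  have in01: "\<forall>\<^sub>F t in at 0 within {0..<1::real}. 0 < t \<and> t < 1"
    by (auto simp: eventually_at_filter)
  show "(U has_real_derivative normalization F p u) (at 0 within {0..<1})"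
  proof (cases "p = u")
    case True
    \<comment> \<open>The segment is the single point \<open>u\<close>, so \<open>U\<close> is
      constant on the half-open interval.\<close>
    have "((\<lambda>_. u) has_real_derivative 0) (at 0 within {0..<1})" by simp
    then have "(U has_real_derivative 0) (at 0 within {0..<1})"
      by (rule has_field_derivative_transform_within[of _ _ _ _ 1]) (use seg True in auto)
    then show ?thesis using Fuu True by (simp add: normalization_def)
  next
    case False
    define c where "c = partial2 (\<lambda>(s, t). F s t) u u"
    have c: "c < 0" "(F u has_real_derivative c) (at u)"
      unfolding c_def using N pu by auto
    \<comment> \<open>At \<open>U t = u\<close> the equation would reduce to
      \<open>t * F p u = 0\<close>. Avoiding \<open>u\<close> makes the quotient by
      \<open>U t - u\<close> meaningful and lets the limit at the punctured point \<open>u\<close>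
      be composed with \<open>U\<close>.\<close>
    have Uu: "U t \<noteq> u" if "0 < t" "t < 1" for t
      using zero[of t] that nz[OF pu False] Fuu by auto
    have lim: "(U \<longlongrightarrow> u) (at 0 within {0..<1})"
    proof (rule tendstoI)
      fix r :: real assume r: "0 < r"
      \<comment> \<open>On this compact set \<open>F u\<close> has no zero, so
        \<open>F p / F u\<close> is bounded by some \<open>k\<close>. A zero \<open>U t\<close> in
        \<open>S\<close> would force \<open>1 - t \<le> t * k\<close>, which fails for small
        \<open>t\<close>.\<close>
      define S where "S = closed_segment p u - ball u r"
      have S: "S \<subseteq> J" "u \<notin> S" using sub r by (auto simp: S_def)
      have "compact S" unfolding S_def by (intro compact_diff) auto
      moreover have "continuous_on S (\<lambda>y. F p y / F u y)"
        using S nz[OF pu(2)] by (intro continuous_intros continuous_on_subset[OF N(2)] pu) blast+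
      ultimately have "bounded ((\<lambda>y. F p y / F u y) ` S)"
        using compact_continuous_image compact_imp_bounded by blast
      then obtain k where k: "\<And>y. y \<in> S \<Longrightarrow> \<bar>F p y / F u y\<bar> \<le> k"
        by (force simp: bounded_iff)
      have "((\<lambda>t. 1 - t - t * k) \<longlongrightarrow> 1 - 0 - 0 * k) (at 0 within {0..<1::real})"
        by (intro tendsto_intros)
      then have "\<forall>\<^sub>F t in at 0 within {0..<1}. 0 < 1 - t - t * k"
        by (rule order_tendstoD) simp
      with in01 show "\<forall>\<^sub>F t in at 0 within {0..<1}. dist (U t) u < r"
      proof eventually_elim
        case (elim t)
        show ?case
        proof (rule ccontr)
          assume "\<not> ?thesis"
          then have US: "U t \<in> S" using seg[of t] elim by (auto simp: S_def dist_commute)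
          then have "F u (U t) \<noteq> 0" using S nz[OF pu(2)] by blast
          then have "1 - t = - t * (F p (U t) / F u (U t))"
            using zero[of t] elim by (simp add: field_simps)
          also have "\<dots> \<le> t * k"
            using k[OF US] elim mult_left_mono[of "- (F p (U t) / F u (U t))" k t] by linarith
          finally show False using elim by linarith
        qed
      qed
    qed
    have "((\<lambda>y. F u y / (y - u)) \<longlongrightarrow> c) (at u)"
      using c(2) by (simp add: has_field_derivative_iff Fuu)
    moreover have "filterlim U (at u) (at 0 within {0..<1})"
      unfolding filterlim_at using lim eventually_mono[OF in01, of "\<lambda>t. U t \<noteq> u"] Uu by simp
    ultimately have Q: "((\<lambda>t. F u (U t) / (U t - u)) \<longlongrightarrow> c) (at 0 within {0..<1})"
      by (rule filterlim_compose)
    have "isCont (F p) u"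
      using N(2) J(1) pu continuous_on_eq_continuous_at by blast
    then have P: "((\<lambda>t. F p (U t)) \<longlongrightarrow> F p u) (at 0 within {0..<1})"
      using lim isCont_tendsto_compose by blast
    have "((\<lambda>t. F p (U t) / (- (1 - t) * (F u (U t) / (U t - u)))) \<longlongrightarrow> F p u / (- (1 - 0) * c))
        (at 0 within {0..<1})"
      using c by (intro tendsto_intros P Q) auto
    then have "((\<lambda>t. F p (U t) / (- (1 - t) * (F u (U t) / (U t - u)))) \<longlongrightarrow> F p u / (- c))
        (at 0 within {0..<1})"
      by simp
    then have "((\<lambda>t. (U t - U 0) / (t - 0)) \<longlongrightarrow> F p u / (- c)) (at 0 within {0..<1})"
    proof (rule Lim_transform_eventually)
      show "\<forall>\<^sub>F t in at 0 within {0..<1}.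
          F p (U t) / (- (1 - t) * (F u (U t) / (U t - u))) = (U t - U 0) / (t - 0)"
        using in01
      proof eventually_elim
        case (elim t)
        have "F u (U t) \<noteq> 0" using seg[of t] sub nz[OF pu(2), of "U t"] Uu[of t] elim by auto
        moreover have eq: "- (1 - t) * F u (U t) = t * F p (U t)"
          using zero[of t] elim by (simp add: algebra_simps)
        ultimately have "F p (U t) \<noteq> 0" using elim by auto
        moreover have "- (1 - t) * (F u (U t) / (U t - u)) = t * F p (U t) / (U t - u)"
          using eq by (metis times_divide_eq_right)
        ultimately show ?case
          using Uu[of t] elim by (simp only: U0) (simp add: divide_simps)
      qed
    qed
    then show ?thesis by (simp add: has_field_derivative_iff normalization_def c_def)
  qed
qed

text \<open>With a common value at 0, the inequality for \<open>t > 0\<close> passes to the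
  difference quotients and then to their one-sided limits.\<close>

lemma has_real_derivative_mono_right:
  fixes g h :: "real \<Rightarrow> real"
  assumes "(g has_real_derivative a) (at 0 within {0..<1})"
    and "(h has_real_derivative b) (at 0 within {0..<1})"
    and "g 0 = h 0" "\<And>t. t \<in> {0<..<1} \<Longrightarrow> g t \<le> h t"
  shows "a \<le> b"
proof (rule tendsto_le)
  show "((\<lambda>t. (h t - h 0) / (t - 0)) \<longlongrightarrow> b) (at 0 within {0..<1})"
    and "((\<lambda>t. (g t - g 0) / (t - 0)) \<longlongrightarrow> a) (at 0 within {0..<1})"
    using assms(1,2) by (simp_all add: has_field_derivative_iff)
  show "at 0 within {0..<1::real} \<noteq> bot"
    by (simp add: trivial_limit_within islimpt_Ico)
  show "\<forall>\<^sub>F t in at 0 within {0..<1}. (g t - g 0) / (t - 0) \<le> (h t - h 0) / (t - 0)"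
    using assms(3,4) by (auto simp: eventually_at_filter divide_right_mono)
qed

text \<open>Serves for the entries and for the weights. Every index other than 1 carries the second
  value, so applying \<open>f\<close> entrywise yields a \<open>two_points\<close> again as an
  equality of total functions.\<close>

definition two_points :: "real \<Rightarrow> real \<Rightarrow> nat \<Rightarrow> real" where
  "two_points p u i = (if i = 1 then p else u)"

lemma two_points_weights: "t \<in> {0..<1} \<Longrightarrow> two_points t (1 - t) \<in> weights 2"
  by (auto simp: weights_def two_points_def numeral_2_eq_2)

lemma two_points_in: "p \<in> J \<Longrightarrow> u \<in> J \<Longrightarrow> two_points p u \<in> A \<rightarrow> J"
  by (auto simp: two_points_def)

lemma dev_sum_two_points:
  "dev_sum F 2 (two_points p u) (two_points t (1 - t)) y = t * F p y + (1 - t) * F u y"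
  by (simp add: dev_sum_def two_points_def numeral_2_eq_2)

text \<open>\<open>D_ll\<close> and \<open>D_uu\<close> are both zeros of the weighted sum lying
  between \<open>p\<close> and \<open>u\<close>, hence both are admissible choices of
  \<open>U\<close>. They share value and right derivative at \<open>t = 0\<close>, even where they
  differ for \<open>t > 0\<close>.\<close>

lemma two_point_means_has_derivative:
  fixes J :: "real set"
  assumes J: "open J" "is_interval J" and F: "normalizable J F" and pu: "p \<in> J" "u \<in> J"
  shows "D_ll J F 2 (two_points p u) (two_points 0 (1 - 0)) = u"
    and "D_uu J F 2 (two_points p u) (two_points 0 (1 - 0)) = u"
    and "((\<lambda>t. D_ll J F 2 (two_points p u) (two_points t (1 - t)))
      has_real_derivative normalization F p u) (at 0 within {0..<1})"
    and "((\<lambda>t. D_uu J F 2 (two_points p u) (two_points t (1 - t)))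
      has_real_derivative normalization F p u) (at 0 within {0..<1})"
proof -
  define X where "X = two_points p u"
  define L where "L t = two_points t (1 - t)" for t
  have W: "weighted_tuple J F 2 X (L t)" if "t \<in> {0..<1}" for t
    unfolding L_def X_def
    by (intro weighted_tupleI J F two_points_in pu two_points_weights that)
  have mem: "min p u \<in> J" "max p u \<in> J" using pu by (auto simp: min_def max_def)
  have bnd: "min p u \<le> X i" "X i \<le> max p u" for i by (auto simp: X_def two_points_def)
  have seg: "D_ll J F 2 X (L t) \<in> closed_segment p u" "D_uu J F 2 X (L t) \<in> closed_segment p u"
    if "t \<in> {0..<1}" for t
    using weighted_tuple.D_ll_ge_bound[OF W[OF that] mem bnd]
      weighted_tuple.D_uu_le_bound[OF W[OF that] mem bnd]
      weighted_tuple.D_ll_le_D_uu[OF W[OF that]]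
    by (auto simp: closed_segment_eq_real_ivl split: if_splits)
  have zero: "t * F p (D_ll J F 2 X (L t)) + (1 - t) * F u (D_ll J F 2 X (L t)) = 0"
    "t * F p (D_uu J F 2 X (L t)) + (1 - t) * F u (D_uu J F 2 X (L t)) = 0"
    if "t \<in> {0..<1}" for t
    using weighted_tuple.e_D_ll[OF W[OF that]] weighted_tuple.e_D_uu[OF W[OF that]]
    unfolding X_def L_def dev_sum_two_points by blast+
  note ll = zero_of_mixture_has_derivative[OF J F pu seg(1) zero(1)]
  note uu = zero_of_mixture_has_derivative[OF J F pu seg(2) zero(2)]
  show "D_ll J F 2 (two_points p u) (two_points 0 (1 - 0)) = u"
    and "D_uu J F 2 (two_points p u) (two_points 0 (1 - 0)) = u"
    and "((\<lambda>t. D_ll J F 2 (two_points p u) (two_points t (1 - t)))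
      has_real_derivative normalization F p u) (at 0 within {0..<1})"
    and "((\<lambda>t. D_uu J F 2 (two_points p u) (two_points t (1 - t)))
      has_real_derivative normalization F p u) (at 0 within {0..<1})"
    using ll uu unfolding X_def L_def by blast+
qed

section \<open>Comparison of means under an increasing map\<close>

text \<open>The partial derivatives are given by \<open>deriv\<close> along the axes. Composing the
  total derivative \<open>D\<close> with the two axis-parallel lines identifies them as
  \<open>D (1, 0)\<close> and \<open>D (0, 1)\<close>, and linearity recovers
  \<open>D\<close>.\<close>

lemma partials:
  assumes "f differentiable at (u, v)"
  shows "(f has_derivative (\<lambda>(a, b). partial1 f u v * a + partial2 f u v * b)) (at (u, v))"
    and "((\<lambda>s. f (s, v)) has_real_derivative partial1 f u v) (at u)"
    and "((\<lambda>t. f (u, t)) has_real_derivative partial2 f u v) (at v)"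
proof -
  obtain D where D: "(f has_derivative D) (at (u, v))"
    using assms by (auto simp: differentiable_def)
  interpret linear D using D by (rule has_derivative_linear)
  have split: "D (a, b) = a * D (1, 0) + b * D (0, 1)" for a b
    using add[of "(a, 0)" "(0, b)"] scale[of a "(1, 0)"] scale[of b "(0, 1)"] by simp
  have "D (h, 0) = D (1, 0) * h" "D (0, h) = D (0, 1) * h" for h
    using split[of h 0] split[of 0 h] by simp_all
  then have D1: "(\<lambda>h. D (h, 0)) = (*) (D (1, 0))" and D2: "(\<lambda>h. D (0, h)) = (*) (D (0, 1))"
    by blast+
  have "((\<lambda>s. f (s, v)) has_derivative (\<lambda>h. D (h, 0))) (at u)"
    by (rule has_derivative_compose[of "\<lambda>s. (s, v)" "\<lambda>h. (h, 0)" _ _ f D, OF _ D])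
      (auto intro!: derivative_eq_intros)
  then have d1: "((\<lambda>s. f (s, v)) has_real_derivative D (1, 0)) (at u)"
    unfolding has_field_derivative_def D1 .
  have "((\<lambda>t. f (u, t)) has_derivative (\<lambda>h. D (0, h))) (at v)"
    by (rule has_derivative_compose[of "\<lambda>t. (u, t)" "\<lambda>h. (0, h)" _ _ f D, OF _ D])
      (auto intro!: derivative_eq_intros)
  then have d2: "((\<lambda>t. f (u, t)) has_real_derivative D (0, 1)) (at v)"
    unfolding has_field_derivative_def D2 .
  have eq: "partial1 f u v = D (1, 0)" "partial2 f u v = D (0, 1)"
    unfolding partial1_def partial2_def using d1 d2 by (auto intro: DERIV_imp_deriv)
  show "((\<lambda>s. f (s, v)) has_real_derivative partial1 f u v) (at u)"
    and "((\<lambda>t. f (u, t)) has_real_derivative partial2 f u v) (at v)"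
    using d1 d2 unfolding eq by blast+
  have "D = (\<lambda>(a, b). partial1 f u v * a + partial2 f u v * b)"
  proof (rule ext, clarify)
    show "D (a, b) = partial1 f u v * a + partial2 f u v * b" for a b
      using split[of a b] by (simp add: eq mult.commute)
  qed
  with D show "(f has_derivative (\<lambda>(a, b). partial1 f u v * a + partial2 f u v * b)) (at (u, v))"
    by simp
qed

text \<open>The normalizing denominator depends only on the second argument, so it is common to all
  summands.\<close>

lemma dev_sum_normalization:
  "dev_sum (normalization E) n x l u = dev_sum E n x l u / (- partial2 (\<lambda>(s, t). E s t) u u)"
  unfolding dev_sum_def normalization_def by (simp only: sum_divide_distrib times_divide_eq_right)

section \<open>Monotonicity of \<open>f\<close>, and the pointwise inequality (vi) from the mean
  inequality (v)\<close>

locale mean_comparison =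
  fixes I J K :: "real set" and E F G :: "real \<Rightarrow> real \<Rightarrow> real" and f :: "real \<times> real \<Rightarrow> real"
  assumes I: "open I" "is_interval I" and J: "open J" "is_interval J"
    and K: "open K" "is_interval K"
    and E: "normalizable I E" and F: "normalizable J F" and G: "normalizable K G"
    and f_maps: "f \<in> J \<times> K \<rightarrow> I"
    and f_diff: "f differentiable_on (J \<times> K)"
    and f_partials: "\<And>u v. u \<in> J \<Longrightarrow> v \<in> K \<Longrightarrow>
      0 \<le> partial1 f u v \<and> 0 \<le> partial2 f u v \<and> 0 < partial1 f u v + partial2 f u v"
begin

lemma f_in: "u \<in> J \<Longrightarrow> v \<in> K \<Longrightarrow> f (u, v) \<in> I"
  using f_maps by auto

lemma f_differentiable: "u \<in> J \<Longrightarrow> v \<in> K \<Longrightarrow> f differentiable at (u, v)"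
  using f_diff differentiable_on_eq_differentiable_at[OF open_Times[OF J(1) K(1)]] by auto

lemmas f_has_derivative = partials(1)[OF f_differentiable]
  and f_has_partial_derivatives = partials(2,3)[OF f_differentiable]

lemma f_isCont: "u \<in> J \<Longrightarrow> v \<in> K \<Longrightarrow> isCont f (u, v)"
  using f_has_derivative has_derivative_continuous by blast

lemma f_mono:
  assumes "u \<in> J" "u' \<in> J" "v \<in> K" "v' \<in> K" "u \<le> u'" "v \<le> v'"
  shows "f (u, v) \<le> f (u', v')"
proof -
  have "f (u, v) \<le> f (u', v)"
  proof (rule DERIV_nonneg_imp_nondecreasing[OF assms(5)])
    fix s assume "u \<le> s" "s \<le> u'"
    then have "s \<in> J" using assms J(2) unfolding is_interval_1 by blast
    then show "\<exists>d. ((\<lambda>s. f (s, v)) has_real_derivative d) (at s) \<and> 0 \<le> d"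
      using f_has_partial_derivatives f_partials assms(3) by blast
  qed
  also have "\<dots> \<le> f (u', v')"
  proof (rule DERIV_nonneg_imp_nondecreasing[OF assms(6)])
    fix s assume "v \<le> s" "s \<le> v'"
    then have "s \<in> K" using assms K(2) unfolding is_interval_1 by blast
    then show "\<exists>d. ((\<lambda>t. f (u', t)) has_real_derivative d) (at s) \<and> 0 \<le> d"
      using f_has_partial_derivatives f_partials assms(2) by blast
  qed
  finally show ?thesis .
qed

lemma weighted_tuples:
  assumes "x \<in> {1..n} \<rightarrow> J" "y \<in> {1..n} \<rightarrow> K" "l \<in> weights n"
  shows "weighted_tuple J F n x l" "weighted_tuple K G n y l"
    and "weighted_tuple I E n (\<lambda>i. f (x i, y i)) l"
proof -
  have "(\<lambda>i. f (x i, y i)) \<in> {1..n} \<rightarrow> I"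
    by (intro Pi_I f_in) (use assms in blast)+
  then show "weighted_tuple J F n x l" "weighted_tuple K G n y l"
    and "weighted_tuple I E n (\<lambda>i. f (x i, y i)) l"
    by (intro weighted_tupleI assms I J K E F G)+
qed

text \<open>With weights \<open>L t\<close> both sides of (v) equal \<open>f (u, v)\<close> at
  \<open>t = 0\<close>. The chain rule, applied to the one-sided curve of means in the plane, gives
  the right derivatives there, which are the two sides of the claim.\<close>

lemma normalization_ineq_if_mean_ineq:
  assumes v: "\<And>n x y l. x \<in> {1..n} \<rightarrow> J \<Longrightarrow> y \<in> {1..n} \<rightarrow> K \<Longrightarrow> l \<in> weights n \<Longrightarrow>
      D_ll I E n (\<lambda>i. f (x i, y i)) l \<le> f (D_uu J F n x l, D_uu K G n y l)"
    and pq: "p \<in> J" "u \<in> J" "q \<in> K" "v \<in> K"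
  shows "normalization E (f (p, q)) (f (u, v))
      \<le> partial1 f u v * normalization F p u + partial2 f u v * normalization G q v"
proof -
  define L where "L t = two_points t (1 - t)" for t
  define X Y where "X = two_points p u" and "Y = two_points q v"
  have fXY: "(\<lambda>i. f (X i, Y i)) = two_points (f (p, q)) (f (u, v))"
    by (auto simp: X_def Y_def two_points_def)
  note dF = two_point_means_has_derivative(2,4)[OF J F pq(1,2), folded X_def L_def]
  note dG = two_point_means_has_derivative(2,4)[OF K G pq(3,4), folded Y_def L_def]
  note dE = two_point_means_has_derivative(1,3)[OF I E f_in[OF pq(1,3)] f_in[OF pq(2,4)],
      folded fXY L_def]
  have "((\<lambda>t. (D_uu J F 2 X (L t), D_uu K G 2 Y (L t))) has_derivative
      (\<lambda>h. (normalization F p u * h, normalization G q v * h))) (at 0 within {0..<1})"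
    using dF(2) dG(2) by (intro has_derivative_Pair) (auto simp: has_field_derivative_def)
  moreover have "(f has_derivative (\<lambda>(a, b). partial1 f u v * a + partial2 f u v * b))
      (at (D_uu J F 2 X (L 0), D_uu K G 2 Y (L 0)))"
    unfolding dF(1) dG(1) by (rule f_has_derivative[OF pq(2,4)])
  ultimately have "((\<lambda>t. f (D_uu J F 2 X (L t), D_uu K G 2 Y (L t))) has_derivative
      (\<lambda>h. (\<lambda>(a, b). partial1 f u v * a + partial2 f u v * b)
        (normalization F p u * h, normalization G q v * h))) (at 0 within {0..<1})"
    by (rule has_derivative_compose)
  then have "((\<lambda>t. f (D_uu J F 2 X (L t), D_uu K G 2 Y (L t))) has_real_derivative
      partial1 f u v * normalization F p u + partial2 f u v * normalization G q v)
      (at 0 within {0..<1})"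
    unfolding has_field_derivative_def by (rule has_derivative_eq_rhs) (auto simp: algebra_simps)
  with dE(2) show ?thesis
  proof (rule has_real_derivative_mono_right)
    show "D_ll I E 2 (\<lambda>i. f (X i, Y i)) (L 0) = f (D_uu J F 2 X (L 0), D_uu K G 2 Y (L 0))"
      by (simp only: dE(1) dF(1) dG(1))
    show "D_ll I E 2 (\<lambda>i. f (X i, Y i)) (L t) \<le> f (D_uu J F 2 X (L t), D_uu K G 2 Y (L t))"
      if "t \<in> {0<..<1}" for t
      unfolding X_def Y_def L_def using that pq by (intro v two_points_in two_points_weights) auto
  qed
qed

section \<open>From the pointwise inequality (vi) to the mean inequalities (i)-(iv)\<close>

context
  fixes n :: nat and x y l :: "nat \<Rightarrow> real"
  assumes vi: "\<And>p u q v. p \<in> J \<Longrightarrow> u \<in> J \<Longrightarrow> q \<in> K \<Longrightarrow> v \<in> K \<Longrightarrow>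
      normalization E (f (p, q)) (f (u, v))
        \<le> partial1 f u v * normalization F p u + partial2 f u v * normalization G q v"
    and x: "x \<in> {1..n} \<rightarrow> J" and y: "y \<in> {1..n} \<rightarrow> K" and l: "l \<in> weights n"
begin

interpretation F: weighted_tuple J F n x l by (rule weighted_tuples[OF x y l])
interpretation G: weighted_tuple K G n y l by (rule weighted_tuples[OF x y l])
interpretation E: weighted_tuple I E n "\<lambda>i. f (x i, y i)" l by (rule weighted_tuples[OF x y l])

lemma dev_sum_ineq:
  assumes "u \<in> J" "v \<in> K"
  shows "dev_sum (normalization E) n (\<lambda>i. f (x i, y i)) l (f (u, v))
    \<le> partial1 f u v * dev_sum (normalization F) n x l u
      + partial2 f u v * dev_sum (normalization G) n y l v"
proof -
  have "dev_sum (normalization E) n (\<lambda>i. f (x i, y i)) l (f (u, v))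
    \<le> (\<Sum>i=1..n. l i * (partial1 f u v * normalization F (x i) u
        + partial2 f u v * normalization G (y i) v))"
    unfolding dev_sum_def
    by (intro sum_mono mult_left_mono vi assms funcset_mem[OF x] funcset_mem[OF y] E.l_nonneg)
  also have "\<dots> = partial1 f u v * dev_sum (normalization F) n x l u
      + partial2 f u v * dev_sum (normalization G) n y l v"
    by (simp add: dev_sum_def sum.distrib sum_distrib_left algebra_simps)
  finally show ?thesis .
qed

text \<open>Normalizing divides each sum by a positive number, so signs can be read off from
  \<open>dev_sum_ineq\<close>.\<close>

lemma dev_sum_sign:
  assumes "u \<in> J" "v \<in> K"
  shows "F.e u \<le> 0 \<Longrightarrow> G.e v \<le> 0 \<Longrightarrow> E.e (f (u, v)) \<le> 0"
    and "F.e u < 0 \<Longrightarrow> G.e v < 0 \<Longrightarrow> E.e (f (u, v)) < 0"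
proof -
  define cE cF cG where "cE = - partial2 (\<lambda>(s, t). E s t) (f (u, v)) (f (u, v))"
    and "cF = - partial2 (\<lambda>(s, t). F s t) u u" and "cG = - partial2 (\<lambda>(s, t). G s t) v v"
  have c: "0 < cE" "0 < cF" "0 < cG"
    using normalizableD(3)[OF E f_in[OF assms]] normalizableD(3)[OF F assms(1)]
      normalizableD(3)[OF G assms(2)] by (auto simp: cE_def cF_def cG_def)
  define a b where "a = partial1 f u v" and "b = partial2 f u v"
  have ab: "0 \<le> a" "0 \<le> b" "0 < a + b" using f_partials[OF assms] by (auto simp: a_def b_def)
  have ineq: "E.e (f (u, v)) / cE \<le> a * (F.e u / cF) + b * (G.e v / cG)"
    using dev_sum_ineq[OF assms] unfolding dev_sum_normalization cE_def cF_def cG_def a_def b_def .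
  show "E.e (f (u, v)) \<le> 0" if "F.e u \<le> 0" "G.e v \<le> 0"
  proof -
    have "a * (F.e u / cF) \<le> 0" "b * (G.e v / cG) \<le> 0"
      using that c ab by (auto intro!: mult_nonneg_nonpos divide_nonpos_pos)
    with ineq have "E.e (f (u, v)) / cE \<le> 0" by linarith
    then show ?thesis using c by (simp add: divide_le_0_iff)
  qed
  show "E.e (f (u, v)) < 0" if "F.e u < 0" "G.e v < 0"
  proof -
    have neg: "F.e u / cF < 0" "G.e v / cG < 0" using that c by (auto intro: divide_neg_pos)
    have "a * (F.e u / cF) \<le> 0" "b * (G.e v / cG) \<le> 0"
      by (rule mult_nonneg_nonpos[OF ab(1) less_imp_le[OF neg(1)]],
          rule mult_nonneg_nonpos[OF ab(2) less_imp_le[OF neg(2)]])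
    \<comment> \<open>Strictness survives because \<open>a + b > 0\<close> makes at least one of the
      nonnegative coefficients positive.\<close>
    moreover have "a * (F.e u / cF) < 0 \<or> b * (G.e v / cG) < 0"
      using neg ab by (metis add.right_neutral less_eq_real_def less_irrefl mult_pos_neg)
    ultimately have "E.e (f (u, v)) / cE < 0" using ineq by linarith
    then show ?thesis using c by (simp add: divide_less_0_iff)
  qed
qed

text \<open>The infima on the right are attained as zeros, so their image under \<open>f\<close>
  belongs to the set whose infimum stands on the left.\<close>

lemma D_ll_ineq: "D_ll I E n (\<lambda>i. f (x i, y i)) l \<le> f (D_ll J F n x l, D_ll K G n y l)"
  by (intro E.D_ll_le f_in dev_sum_sign F.D_mem G.D_mem) (simp_all add: F.e_D_ll G.e_D_ll)

lemma D_l_ineq: "D_l I E n (\<lambda>i. f (x i, y i)) l \<le> f (D_l J F n x l, D_l K G n y l)"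
proof -
  let ?u = "D_l J F n x l" and ?v = "D_l K G n y l"
  \<comment> \<open>An infimum over a strict inequality need not be attained. It is approached by
    points with negative sums, and continuity of \<open>f\<close> carries the estimate to the
    limit.\<close>
  have "\<exists>u. u \<in> J \<and> F.e u < 0 \<and> u < ?u + inverse (real (Suc k))" for k
    using F.D_l_approx[of "inverse (real (Suc k))"]
    by (metis inverse_positive_iff_positive of_nat_0_less_iff zero_less_Suc)
  then obtain U where U: "\<And>k. U k \<in> J" "\<And>k. F.e (U k) < 0"
    "\<And>k. U k < ?u + inverse (real (Suc k))" by metis
  have "\<exists>v. v \<in> K \<and> G.e v < 0 \<and> v < ?v + inverse (real (Suc k))" for k
    using G.D_l_approx[of "inverse (real (Suc k))"]
    by (metis inverse_positive_iff_positive of_nat_0_less_iff zero_less_Suc)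
  then obtain V where V: "\<And>k. V k \<in> K" "\<And>k. G.e (V k) < 0"
    "\<And>k. V k < ?v + inverse (real (Suc k))" by metis
  have "U \<longlonglongrightarrow> ?u"
    by (rule tendsto_sandwich[OF _ _ tendsto_const LIMSEQ_inverse_real_of_nat_add])
      (use U F.D_l_le in \<open>auto intro!: always_eventually less_imp_le\<close>)
  moreover have "V \<longlonglongrightarrow> ?v"
    by (rule tendsto_sandwich[OF _ _ tendsto_const LIMSEQ_inverse_real_of_nat_add])
      (use V G.D_l_le in \<open>auto intro!: always_eventually less_imp_le\<close>)
  ultimately have "(\<lambda>k. f (U k, V k)) \<longlonglongrightarrow> f (?u, ?v)"
    by (intro isCont_tendsto_compose[OF f_isCont] F.D_mem G.D_mem tendsto_Pair)
  then show ?thesis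
    by (rule tendsto_lowerbound)
      (use U V in \<open>auto intro!: always_eventually E.D_l_le f_in dev_sum_sign(2)\<close>)
qed

text \<open>Prepares the bounds for suprema. A point \<open>z\<close> above
  \<open>f (u0, v0)\<close> either exceeds all values \<open>f (x i, y i)\<close>, making the sum
  negative, or is a value of \<open>f\<close> at a point strictly larger in both coordinates, where
  the signs of both sums are known if \<open>u0\<close> and \<open>v0\<close> are suprema.\<close>

lemma neg_or_attained_above:
  assumes u0: "u0 \<in> J" and v0: "v0 \<in> K" and z: "z \<in> I" "f (u0, v0) < z"
  obtains "E.e z < 0" | u v where "u \<in> J" "v \<in> K" "u0 < u" "v0 < v" "f (u, v) = z"
proof -
  obtain X0 where X0: "X0 \<in> J" "\<And>i. i \<in> {1..n} \<Longrightarrow> x i < X0" using F.ex_strict_upper by blast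
  obtain Y0 where Y0: "Y0 \<in> K" "\<And>i. i \<in> {1..n} \<Longrightarrow> y i < Y0" using G.ex_strict_upper by blast
  obtain u1 where u1: "u1 \<in> J" "u0 < u1"
    using open_real_extend_right[OF J(1) u0 zero_less_one] by blast
  obtain v1 where v1: "v1 \<in> K" "v0 < v1"
    using open_real_extend_right[OF K(1) v0 zero_less_one] by blast
  \<comment> \<open>The corner \<open>(X, Y)\<close> dominates all entries and lies strictly beyond
    \<open>(u0, v0)\<close> in both coordinates.\<close>
  define X Y where "X = max X0 u1" and "Y = max Y0 v1"
  have X: "X \<in> J" "u0 < X" "\<And>i. i \<in> {1..n} \<Longrightarrow> x i \<le> X"
    using X0 u1 by (force simp: X_def max_def)+
  have Y: "Y \<in> K" "v0 < Y" "\<And>i. i \<in> {1..n} \<Longrightarrow> y i \<le> Y"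
    using Y0 v1 by (force simp: Y_def max_def)+
  show thesis
  proof (cases "z \<le> f (X, Y)")
    case False
    have "f (x i, y i) < z" if "i \<in> {1..n}" for i
      using f_mono[of "x i" X "y i" Y] that x y X Y False by fastforce
    then have "E.e z < 0" using z by (intro E.e_neg) auto
    then show thesis by (rule that(1))
  next
    case True
    \<comment> \<open>The intermediate value theorem is applied to \<open>f\<close> along the
      segment to the corner, on which both coordinates increase strictly.\<close>
    define g where "g s = (u0 + s * (X - u0), v0 + s * (Y - v0))" for s
    have "fst (g s) \<in> {u0..X}" "snd (g s) \<in> {v0..Y}" if "0 \<le> s" "s \<le> 1" for s
    proof -
      have "s * (X - u0) \<le> X - u0" "s * (Y - v0) \<le> Y - v0"
        by (intro mult_left_le_one_le; use that X Y in simp)+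
      then have "u0 + s * (X - u0) \<le> X" "v0 + s * (Y - v0) \<le> Y" by linarith+
      then show "fst (g s) \<in> {u0..X}" "snd (g s) \<in> {v0..Y}"
        using that X(2) Y(2) by (auto simp: g_def)
    qed
    then have g: "fst (g s) \<in> J" "snd (g s) \<in> K" if "0 \<le> s" "s \<le> 1" for s
      using that J(2) K(2) u0 v0 X(1) Y(1) unfolding is_interval_1 by (meson atLeastAtMost_iff)+
    have "\<exists>s\<ge>0. s \<le> 1 \<and> f (g s) = z"
    proof (rule IVT)
      show "f (g 0) \<le> z" "z \<le> f (g 1)" using z True by (auto simp: g_def)
      show "\<forall>s. 0 \<le> s \<and> s \<le> 1 \<longrightarrow> isCont (\<lambda>s. f (g s)) s"
      proof (intro allI impI)
        fix s :: real assume "0 \<le> s \<and> s \<le> 1"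
        then have "isCont f (g s)" using f_isCont[of "fst (g s)" "snd (g s)"] g by simp
        moreover have "isCont g s" unfolding g_def by (intro continuous_intros)
        ultimately show "isCont (\<lambda>s. f (g s)) s" by (rule isCont_o2[rotated])
      qed
    qed simp
    then obtain s where s: "0 \<le> s" "s \<le> 1" "f (g s) = z" by blast
    \<comment> \<open>The value at \<open>s = 0\<close> is below \<open>z\<close>; hence
      \<open>s > 0\<close>, which gives both strict inequalities.\<close>
    then have "s \<noteq> 0" using z by (auto simp: g_def)
    then show thesis
      using s g[OF s(1,2)] X Y by (intro that(2)[of "fst (g s)" "snd (g s)"]) (auto simp: g_def)
  qed
qed

text \<open>If some \<open>z\<close> with positive sum exceeded the right side, it would be attained
  at \<open>(u, v)\<close> beyond both suprema. There the sums are nonpositive, so the sum at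
  \<open>z\<close> would be too.\<close>

lemma D_u_ineq: "D_u I E n (\<lambda>i. f (x i, y i)) l \<le> f (D_u J F n x l, D_u K G n y l)"
  unfolding E.D_le_iff
proof (intro ballI impI, rule ccontr)
  fix z assume z: "z \<in> I" "0 < E.e z" "\<not> z \<le> f (D_u J F n x l, D_u K G n y l)"
  then show False
  proof (cases rule: neg_or_attained_above[OF F.D_mem(3) G.D_mem(3) z(1)])
    \<comment> \<open>The first two cases are the remaining premise of the rule and a negative sum
      at \<open>z\<close>; this one is the attained value.\<close>
    case (3 u v)
    then have "F.e u \<le> 0" "G.e v \<le> 0" using F.D_u_ge[of u] G.D_u_ge[of v] by linarith+
    then show False using dev_sum_sign(1)[of u v] 3 z by auto
  qed auto
qed

lemma D_uu_ineq: "D_uu I E n (\<lambda>i. f (x i, y i)) l \<le> f (D_uu J F n x l, D_uu K G n y l)"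
  unfolding E.D_le_iff
proof (intro ballI impI, rule ccontr)
  fix z assume z: "z \<in> I" "0 \<le> E.e z" "\<not> z \<le> f (D_uu J F n x l, D_uu K G n y l)"
  then show False
  proof (cases rule: neg_or_attained_above[OF F.D_mem(4) G.D_mem(4) z(1)])
    case (3 u v)
    then have "F.e u < 0" "G.e v < 0" using F.D_uu_ge[of u] G.D_uu_ge[of v] by linarith+
    then show False using dev_sum_sign(2)[of u v] 3 z by auto
  qed auto
qed

end

text \<open>On the left \<open>D_ll\<close> is the smallest of the four means; on the right
  \<open>D_uu\<close> is the largest in each argument, and \<open>f\<close> is increasing.\<close>

lemma weakest_mean_ineq:
  assumes xyl: "x \<in> {1..n} \<rightarrow> J" "y \<in> {1..n} \<rightarrow> K" "l \<in> weights n"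
  defines "h \<equiv> \<lambda>i. f (x i, y i)"
  assumes "D_ll I E n h l \<le> f (D_ll J F n x l, D_ll K G n y l) \<or>
    D_l I E n h l \<le> f (D_l J F n x l, D_l K G n y l) \<or>
    D_u I E n h l \<le> f (D_u J F n x l, D_u K G n y l) \<or>
    D_uu I E n h l \<le> f (D_uu J F n x l, D_uu K G n y l)"
  shows "D_ll I E n h l \<le> f (D_uu J F n x l, D_uu K G n y l)"
proof -
  interpret F: weighted_tuple J F n x l by (rule weighted_tuples[OF xyl])
  interpret G: weighted_tuple K G n y l by (rule weighted_tuples[OF xyl])
  interpret E: weighted_tuple I E n h l unfolding h_def by (rule weighted_tuples[OF xyl])
  have "f (a, b) \<le> f (D_uu J F n x l, D_uu K G n y l)"
    if "a \<in> J" "b \<in> K" "a \<le> D_uu J F n x l" "b \<le> D_uu K G n y l" for a b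
    using that F.D_mem G.D_mem by (intro f_mono)
  note upper = this[OF F.D_mem(1) G.D_mem(1) F.D_ll_le_D_uu G.D_ll_le_D_uu]
    this[OF F.D_mem(2) G.D_mem(2) F.D_l_le_D_uu G.D_l_le_D_uu]
    this[OF F.D_mem(3) G.D_mem(3) F.D_u_le_D_uu G.D_u_le_D_uu]
  show ?thesis
    using assms(5) upper E.D_ll_le_D_l E.D_ll_le_D_u E.D_ll_le_D_uu by linarith
qed

end

section \<open>The cycle of implications\<close>

theorem theorem7p2:
  fixes I J K :: "real set"
    and E F G :: "real \<Rightarrow> real \<Rightarrow> real"
    and f :: "real \<times> real \<Rightarrow> real"
  assumes "open I" "is_interval I" "open J" "is_interval J" "open K" "is_interval K"
    and "normalizable I E" "normalizable J F" "normalizable K G"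
    and "f \<in> J \<times> K \<rightarrow> I"
    and "f differentiable_on (J \<times> K)"
    and "\<forall>u\<in>J. \<forall>v\<in>K. partial1 f u v \<ge> 0 \<and> partial2 f u v \<ge> 0"
    and "\<forall>u\<in>J. \<forall>v\<in>K. partial1 f u v + partial2 f u v > 0"
  shows "all_equivalent [
     \<forall>n. \<forall>x\<in>{1..n} \<rightarrow> J. \<forall>y\<in>{1..n} \<rightarrow> K. \<forall>l\<in>weights n.
       D_ll I E n (\<lambda>i. f (x i, y i)) l \<le> f (D_ll J F n x l, D_ll K G n y l),
     \<forall>n. \<forall>x\<in>{1..n} \<rightarrow> J. \<forall>y\<in>{1..n} \<rightarrow> K. \<forall>l\<in>weights n.
       D_l I E n (\<lambda>i. f (x i, y i)) l \<le> f (D_l J F n x l, D_l K G n y l),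
     \<forall>n. \<forall>x\<in>{1..n} \<rightarrow> J. \<forall>y\<in>{1..n} \<rightarrow> K. \<forall>l\<in>weights n.
       D_u I E n (\<lambda>i. f (x i, y i)) l \<le> f (D_u J F n x l, D_u K G n y l),
     \<forall>n. \<forall>x\<in>{1..n} \<rightarrow> J. \<forall>y\<in>{1..n} \<rightarrow> K. \<forall>l\<in>weights n.
       D_uu I E n (\<lambda>i. f (x i, y i)) l \<le> f (D_uu J F n x l, D_uu K G n y l),
     \<forall>n. \<forall>x\<in>{1..n} \<rightarrow> J. \<forall>y\<in>{1..n} \<rightarrow> K. \<forall>l\<in>weights n.
       D_ll I E n (\<lambda>i. f (x i, y i)) l \<le> f (D_uu J F n x l, D_uu K G n y l),
     \<forall>p\<in>J. \<forall>u\<in>J. \<forall>q\<in>K. \<forall>v\<in>K.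
       normalization E (f (p, q)) (f (u, v))
         \<le> partial1 f u v * normalization F p u + partial2 f u v * normalization G q v
    ]"
proof -
  interpret mean_comparison I J K E F G f
    using assms by unfold_locales auto
  let ?vi = "\<forall>p\<in>J. \<forall>u\<in>J. \<forall>q\<in>K. \<forall>v\<in>K.
    normalization E (f (p, q)) (f (u, v))
      \<le> partial1 f u v * normalization F p u + partial2 f u v * normalization G q v"
  \<comment> \<open>Assertions (i)-(v) are instances of this one pattern, with the choice of mean on
    each interval as parameter.\<close>
  let ?mean = "\<lambda>DE DF DG. \<forall>n. \<forall>x\<in>{1..n} \<rightarrow> J. \<forall>y\<in>{1..n} \<rightarrow> K. \<forall>l\<in>weights n.
    DE I E n (\<lambda>i. f (x i, y i)) l \<le> f (DF J F n x l, DG K G n y l)"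
  have "?vi \<Longrightarrow> ?mean D_ll D_ll D_ll" "?vi \<Longrightarrow> ?mean D_l D_l D_l"
    "?vi \<Longrightarrow> ?mean D_u D_u D_u" "?vi \<Longrightarrow> ?mean D_uu D_uu D_uu"
    by (intro allI ballI D_ll_ineq D_l_ineq D_u_ineq D_uu_ineq; blast)+
  moreover have "?mean D_ll D_uu D_uu"
    if "?mean D_ll D_ll D_ll \<or> ?mean D_l D_l D_l \<or> ?mean D_u D_u D_u \<or> ?mean D_uu D_uu D_uu"
    using that by (intro allI ballI weakest_mean_ineq) blast+
  moreover have ?vi if "?mean D_ll D_uu D_uu"
    using that by (intro ballI normalization_ineq_if_mean_ineq) blast+
  ultimately show ?thesis
    unfolding all_equivalent_def list.set ball_simps by argo
qed

end
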